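(* Let $M^{(\ell)}_n$ (resp. $M^{(c)}_n$) denote the maximum value of $\mathrm{cr}^{(\ell)}(\pi)$ (resp. $\mathrm{cr}^{(c)}(\pi)$) taken over all $\pi\in\Pi_n$. Then: (1) if $n\ge1$, then $M^{(\ell)}_n=\left\lfloor\frac13\binom{n-1}{2}\right\rfloor$; (2) (a) if $n\ge5$ and $n\equiv0\pmod3$, then $M^{(c)}_n=\left\lfloor\frac23\binom{n-1}{2}\right\rfloor$; (b) if $n\ge5$ and $n\equiv1,2\pmod3$, then $M^{(c)}_n=\left\lfloor\frac23\binom{n-2}{2}\right\rfloor$.
   Context: $\Pi_n$ is the set of all partitions of $[n]=\{1,\dots,n\}$. For $\pi\in\Pi_n$: the arcs of its linear representation are the pairs $(i,j)$, $i<j$, where $i,j$ are consecutive elements (in increasing order) of the same block. $\mathrm{cr}^{(\ell)}(\pi)$ is the number of (unordered) pairs of crossing arcs, i.e. pairs of arcs $(i,j),(i',j')$ with $i<i'<j<j'$. The chords of its circular representation are obtained by placing $1,\dots,n$ in order on a circle and drawing each block as the convex polygon on its elements: a block $\{b_1<\dots<b_m\}$ contributes no chord if $m=1$, the single chord $\{b_1,b_2\}$ if $m=2$, and the $m$ chords $\{b_1,b_2\},\dots,\{b_{m-1},b_m\},\{b_1,b_m\}$ if $m\ge3$. $\mathrm{cr}^{(c)}(\pi)$ is the number of (unordered) pairs of crossing chords, i.e. pairs of chords $\{i,j\},\{i',j'\}$ with $i<i'<j<j'$. *)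

theory Defs
  imports Complex_Main "HOL-Library.Disjoint_Sets"
begin

definition set_partitions :: "nat \<Rightarrow> nat set set set" where
  "set_partitions n = {P. partition_on {1..n} P}"

definition block_arcs :: "nat set \<Rightarrow> (nat \<times> nat) set" where
  "block_arcs B = {(i, j). i \<in> B \<and> j \<in> B \<and> i < j \<and> \<not> (\<exists>k\<in>B. i < k \<and> k < j)}"

text \<open>A chord $\{i, j\}$ with $i < j$ is encoded as the pair $(i, j)$. In a block with two
  elements the closing side of the polygon would be its only arc, so it is added from three
  elements on.\<close>

definition block_chords :: "nat set \<Rightarrow> (nat \<times> nat) set" where
  "block_chords B = block_arcs B \<union> (if card B \<ge> 3 then {(Min B, Max B)} else {})"

definition linear_arcs :: "nat set set \<Rightarrow> (nat \<times> nat) set" where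
  "linear_arcs P = (\<Union>B\<in>P. block_arcs B)"

definition circular_chords :: "nat set set \<Rightarrow> (nat \<times> nat) set" where
  "circular_chords P = (\<Union>B\<in>P. block_chords B)"

text \<open>The requirement $i < i'$ picks exactly one of the two orderings of an unordered crossing
  pair, so every such pair is counted once.\<close>

definition crossings :: "(nat \<times> nat) set \<Rightarrow> nat" where
  "crossings A =
     card {((i, j), (i', j')) | i j i' j'.
             (i, j) \<in> A \<and> (i', j') \<in> A \<and> i < i' \<and> i' < j \<and> j < j'}"

definition cr_linear :: "nat set set \<Rightarrow> nat" where
  "cr_linear P = crossings (linear_arcs P)"

definition cr_circular :: "nat set set \<Rightarrow> nat" where
  "cr_circular P = crossings (circular_chords P)"

definition M_linear :: "nat \<Rightarrow> nat" where
  "M_linear n = Max (cr_linear ` set_partitions n)"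

definition M_circular :: "nat \<Rightarrow> nat" where
  "M_circular n = Max (cr_circular ` set_partitions n)"

end

theory Submission imports Defs begin

text \<open>
  Crossings only occur between different blocks, so it suffices to bound the number \<open>N\<close> of crossings
  between two blocks of sizes \<open>b\<close> and \<open>c\<close>. A chord crosses the sides of a convex polygon at most twice.
  In the circular case this gives \<open>N \<le> 2 min b c\<close>, with smaller values when a block has size one or
  two. In the linear case it gives \<open>N \<le> 2 min b c - 2\<close>, and one less if \<open>b = c \<ge> 2\<close>, because the arc
  from the first point of the earlier block is crossed at most once
  (\<open>card_crossing_chords_le\<close>, \<open>cross_count_arcs_less\<close>).

  To sum these bounds, expand \<open>n\<^sup>2 - 3n\<close>, with \<open>n\<close> the sum of the block sizes, as the sum of \<open>b(b - 3)\<close>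
  over the blocks and \<open>2bc\<close> over the pairs of blocks. In the linear case \<open>2bc - 6N \<ge> 0\<close> for every pair, and
  the negative terms \<open>b(b - 3) = -2\<close> of blocks of size one or two are compensated, up to a total of
  \<open>-2\<close>, by the pairs of such blocks. Hence \<open>6T \<le> n\<^sup>2 - 3n + 2 = (n - 1)(n - 2)\<close> for the total number \<open>T\<close>
  of crossings. In the circular case the same argument with \<open>2bc - 3N\<close> gives \<open>3T \<le> (n - 1)(n - 2)\<close>.
  If \<open>n\<close> is not a multiple of three, some block has size other than three, and then each pair
  containing a suitable such block has weight at least twice the size of the other block; this lowers
  the bound by about \<open>2n\<close>, to \<open>3T \<le> (n - 2)(n - 3)\<close> (\<open>cr_circular_le_not_all_triples\<close>).

  Equality after rounding is attained by the residue classes modulo \<open>d\<close> for about \<open>d = n/3\<close>: two such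
  triples have \<open>3\<close> linear and \<open>6\<close> circular crossings (\<open>cr_linear_ladder_ge\<close>, \<open>cr_circular_ladder_ge\<close>).
  In the circular case with \<open>n = 3d + 1\<close> the additional point is a singleton.
\<close>

section \<open>Crossings between two sets of chords\<close>

definition chords_cross :: "nat \<times> nat \<Rightarrow> nat \<times> nat \<Rightarrow> bool" where
  "chords_cross e f \<longleftrightarrow>
     fst e < fst f \<and> fst f < snd e \<and> snd e < snd f \<or>
     fst f < fst e \<and> fst e < snd f \<and> snd f < snd e"

definition cross_count :: "(nat \<times> nat) set \<Rightarrow> (nat \<times> nat) set \<Rightarrow> nat" where
  "cross_count D E = card {(e, f). e \<in> D \<and> f \<in> E \<and> chords_cross e f}"

lemma chords_cross_sym: "chords_cross e f \<longleftrightarrow> chords_cross f e"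
  by (auto simp: chords_cross_def)

lemma cross_count_commute: "cross_count D E = cross_count E D"
proof -
  have "bij_betw prod.swap {(e, f). e \<in> D \<and> f \<in> E \<and> chords_cross e f}
          {(e, f). e \<in> E \<and> f \<in> D \<and> chords_cross e f}"
    by (rule bij_betwI[where g = prod.swap]) (auto simp: chords_cross_sym)
  then show ?thesis unfolding cross_count_def by (rule bij_betw_same_card)
qed

lemma finite_cross_pairs:
  assumes "finite D" "finite E"
  shows "finite {(e, f). e \<in> D \<and> f \<in> E \<and> chords_cross e f}"
  by (rule finite_subset[of _ "D \<times> E"]) (use assms in auto)

lemma cross_count_eq_sum:
  assumes "finite D" "finite E"
  shows "cross_count D E = (\<Sum>e\<in>D. card {f \<in> E. chords_cross e f})"
proof -
  have "{(e, f). e \<in> D \<and> f \<in> E \<and> chords_cross e f} = (SIGMA e:D. {f \<in> E. chords_cross e f})"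
    by auto
  then show ?thesis
    unfolding cross_count_def using assms by (simp add: card_SigmaI)
qed

lemma cross_count_mono:
  assumes "finite D'" "finite E'" "D \<subseteq> D'" "E \<subseteq> E'"
  shows "cross_count D E \<le> cross_count D' E'"
  unfolding cross_count_def
  by (rule card_mono[OF finite_cross_pairs[OF assms(1,2)]]) (use assms in auto)

text \<open>\<^const>\<open>crossings\<close> orders a crossing pair by its left ends; counting with the symmetric
  relation makes every crossing appear twice, which matches sums over ordered pairs of blocks.\<close>

lemma double_crossings:
  assumes "finite A"
  shows "2 * crossings A = cross_count A A"
proof -
  let ?X = "{((i, j), (i', j')) | i j i' j'.
             (i, j) \<in> A \<and> (i', j') \<in> A \<and> i < i' \<and> i' < j \<and> j < j'}"
  have fin: "finite ?X"
    by (rule finite_subset[of _ "A \<times> A"]) (use assms in auto)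
  have "{(e, f). e \<in> A \<and> f \<in> A \<and> chords_cross e f} = ?X \<union> prod.swap ` ?X"
    by (force simp: chords_cross_def)
  moreover have "?X \<inter> prod.swap ` ?X = {}" by auto
  moreover have "card (prod.swap ` ?X) = card ?X" by (rule card_image) simp
  ultimately show ?thesis
    unfolding crossings_def cross_count_def using fin by (simp add: card_Un_disjoint)
qed

lemma cross_count_UN:
  assumes fin: "finite P" "\<And>B. B \<in> P \<Longrightarrow> finite (D B)"
    and disj: "\<And>B C. B \<in> P \<Longrightarrow> C \<in> P \<Longrightarrow> B \<noteq> C \<Longrightarrow> D B \<inter> D C = {}"
  shows "cross_count (\<Union>B\<in>P. D B) (\<Union>B\<in>P. D B) = (\<Sum>B\<in>P. \<Sum>C\<in>P. cross_count (D B) (D C))"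
proof -
  let ?A = "\<Union>B\<in>P. D B"
  have "cross_count ?A ?A = (\<Sum>e\<in>?A. card {f \<in> ?A. chords_cross e f})"
    using fin by (intro cross_count_eq_sum) auto
  also have "\<dots> = (\<Sum>B\<in>P. \<Sum>e\<in>D B. card {f \<in> ?A. chords_cross e f})"
    using fin disj by (intro sum.UNION_disjoint) auto
  also have "\<dots> = (\<Sum>B\<in>P. \<Sum>e\<in>D B. \<Sum>C\<in>P. card {f \<in> D C. chords_cross e f})"
  proof (intro sum.cong refl)
    fix e
    have "{f \<in> ?A. chords_cross e f} = (\<Union>C\<in>P. {f \<in> D C. chords_cross e f})" by auto
    moreover have "{f \<in> D C. chords_cross e f} \<inter> {f \<in> D C'. chords_cross e f} = {}"
      if "C \<in> P" "C' \<in> P" "C \<noteq> C'" for C C'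
      using disj[OF that] by blast
    ultimately show "card {f \<in> ?A. chords_cross e f} = (\<Sum>C\<in>P. card {f \<in> D C. chords_cross e f})"
      using fin by (simp only:) (intro card_UN_disjoint, simp_all)
  qed
  also have "\<dots> = (\<Sum>B\<in>P. \<Sum>C\<in>P. \<Sum>e\<in>D B. card {f \<in> D C. chords_cross e f})"
    by (intro sum.cong refl sum.swap)
  also have "\<dots> = (\<Sum>B\<in>P. \<Sum>C\<in>P. cross_count (D B) (D C))"
    using fin by (intro sum.cong refl) (simp add: cross_count_eq_sum)
  finally show ?thesis .
qed

section \<open>Crossings within a block and between two blocks\<close>

lemma block_arcs_subset: "block_arcs B \<subseteq> B \<times> B"
  by (auto simp: block_arcs_def)

lemma block_arcs_subset_chords: "block_arcs B \<subseteq> block_chords B"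
  by (auto simp: block_chords_def)

lemma block_chords_subset:
  assumes "finite B"
  shows "block_chords B \<subseteq> B \<times> B"
proof -
  have "B \<noteq> {}" if "3 \<le> card B" using that by auto
  then show ?thesis
    using assms block_arcs_subset unfolding block_chords_def by auto
qed

lemma finite_block_chords [simp]: "finite B \<Longrightarrow> finite (block_chords B)"
  using block_chords_subset finite_subset by blast

lemma finite_block_arcs [simp]: "finite B \<Longrightarrow> finite (block_arcs B)"
  using block_arcs_subset finite_subset by blast

text \<open>A convex polygon has no crossing sides: an end of one chord lying strictly inside another
  would be an element of the block between consecutive ones, or beyond its extremes.\<close>

lemma chords_same_block_not_cross:
  assumes "finite B" "e \<in> block_chords B" "f \<in> block_chords B"
  shows "\<not> chords_cross e f"
proof -
  have "Min B \<le> x \<and> x \<le> Max B" if "x \<in> B" for x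
    using that assms(1) by simp
  then show ?thesis using assms(2,3)
    unfolding block_chords_def block_arcs_def chords_cross_def
    by (fastforce split: if_splits)
qed

lemma cross_count_same_block:
  assumes "finite B"
  shows "cross_count (block_chords B) (block_chords B) = 0"
    and "cross_count (block_arcs B) (block_arcs B) = 0"
proof -
  have no: "\<not> chords_cross e f" if "e \<in> block_chords B" "f \<in> block_chords B" for e f
    using chords_same_block_not_cross[OF assms] that by blast
  then have "{(e, f). e \<in> block_chords B \<and> f \<in> block_chords B \<and> chords_cross e f} = {}"
    by blast
  then show "cross_count (block_chords B) (block_chords B) = 0"
    by (simp only: cross_count_def card.empty)
  have "{(e, f). e \<in> block_arcs B \<and> f \<in> block_arcs B \<and> chords_cross e f} = {}"
    using no block_arcs_subset_chords by blast
  then show "cross_count (block_arcs B) (block_arcs B) = 0"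
    by (simp only: cross_count_def card.empty)
qed

lemma card_block_arcs_le:
  assumes "finite B"
  shows "card (block_arcs B) \<le> card B - 1"
proof -
  have "inj_on fst (block_arcs B)"
    by (auto simp: inj_on_def block_arcs_def) (meson linorder_neqE_nat)+
  moreover have "fst ` block_arcs B \<subseteq> B - {Max B}"
    using assms by (auto simp: block_arcs_def) (metis Max_ge leD)
  ultimately have "card (block_arcs B) \<le> card (B - {Max B})"
    using assms by (metis card_inj_on_le finite_Diff)
  also have "\<dots> = card B - 1"
    using assms by (cases "B = {}") (auto simp: card_Diff_singleton)
  finally show ?thesis .
qed

lemma card_block_chords_le:
  assumes "finite B"
  shows "card (block_chords B) \<le> (if 3 \<le> card B then card B else card B - 1)"
proof (cases "3 \<le> card B")
  case True
  have "card (block_chords B) \<le> card (block_arcs B) + 1"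
    using True assms by (simp add: block_chords_def card_insert_if)
  with card_block_arcs_le[OF assms] True show ?thesis by simp
next
  case False
  with card_block_arcs_le[OF assms] show ?thesis by (simp add: block_chords_def)
qed

lemma card_arcs_straddling_le:
  assumes "finite B"
  shows "card {e \<in> block_arcs B. fst e < x \<and> x < snd e} \<le> 1"
proof -
  have "e = f" if "e \<in> block_arcs B" "fst e < x" "x < snd e"
     "f \<in> block_arcs B" "fst f < x" "x < snd f" for e f
  proof -
    obtain i j i' j' where [simp]: "e = (i, j)" "f = (i', j')" by fastforce
    have "i \<in> B" "j \<in> B" "i' \<in> B" "j' \<in> B" "i < x" "x < j" "i' < x" "x < j'"
      and no: "\<And>k. k \<in> B \<Longrightarrow> i < k \<Longrightarrow> \<not> k < j" "\<And>k. k \<in> B \<Longrightarrow> i' < k \<Longrightarrow> \<not> k < j'"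
      using that by (auto simp: block_arcs_def)
    then have "\<not> i < i'" "\<not> i' < i" "\<not> j < j'" "\<not> j' < j"
      by (meson less_trans)+
    then show ?thesis by simp
  qed
  then show ?thesis using assms by (intro card_le_Suc0_iff_eq[THEN iffD2, unfolded One_nat_def[symmetric]]) auto
qed

text \<open>A line meets the boundary of a convex polygon at most twice. In terms of arcs: a side that is
  crossed by \<open>(x, y)\<close> straddles \<open>x\<close> or \<open>y\<close>, and each point is straddled by at most one arc. If the
  closing side is crossed too, then one of \<open>x\<close>, \<open>y\<close> lies outside the range of the block, so only the
  arc over the other one remains.\<close>

lemma card_crossing_chords_le:
  assumes fin: "finite B"
  shows "card {f \<in> block_chords B. chords_cross e f} \<le> 2"
proof -
  define L where "L x = {f \<in> block_arcs B. fst f < x \<and> x < snd f}" for x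
  have L: "card (L x) \<le> 1" "finite (L x)" for x
    using card_arcs_straddling_le[OF fin] fin by (auto simp: L_def)
  obtain x y where e: "e = (x, y)" by fastforce
  let ?S = "{f \<in> block_chords B. chords_cross e f}"
  let ?c = "(Min B, Max B)"
  have range: "Min B \<le> fst f" "snd f \<le> Max B" if "f \<in> block_arcs B" for f
    using that fin by (auto simp: block_arcs_def)
  have "\<exists>U V. ?S \<subseteq> U \<union> V \<and> card U \<le> 1 \<and> card V \<le> 1 \<and> finite U \<and> finite V"
  proof (cases "chords_cross e ?c")
    case False
    then have "?S \<subseteq> L x \<union> L y"
      by (auto simp: e L_def block_chords_def chords_cross_def split: if_splits)
    with L show ?thesis by blast
  next
    case True
    then have "?S \<subseteq> {?c} \<union> L x \<or> ?S \<subseteq> {?c} \<union> L y"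
      using range by (fastforce simp: e L_def block_chords_def chords_cross_def split: if_splits)
    then obtain z where z: "?S \<subseteq> {?c} \<union> L z" by blast
    show ?thesis
      by (rule exI[of _ "{?c}"], rule exI[of _ "L z"]) (use z in \<open>simp only: L, simp\<close>)
  qed
  then obtain U V where "?S \<subseteq> U \<union> V" "card U \<le> 1" "card V \<le> 1" "finite U" "finite V" by blast
  then have "card ?S \<le> card U + card V"
    by (meson card_Un_le card_mono finite_UnI le_trans)
  with \<open>card U \<le> 1\<close> \<open>card V \<le> 1\<close> show ?thesis by simp
qed

lemma cross_count_chords_le:
  assumes "finite B" "finite C"
  shows "cross_count (block_chords B) (block_chords C) \<le> 2 * card (block_chords B)"
proof -
  have "cross_count (block_chords B) (block_chords C) \<le> (\<Sum>e\<in>block_chords B. 2)"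
    using assms card_crossing_chords_le by (simp only: cross_count_eq_sum finite_block_chords) (intro sum_mono, auto)
  then show ?thesis by simp
qed

lemma cross_count_le_prod:
  assumes "finite D" "finite E"
  shows "cross_count D E \<le> card D * card E"
proof -
  have "cross_count D E \<le> card (D \<times> E)"
    unfolding cross_count_def by (rule card_mono) (use assms in auto)
  then show ?thesis by (simp add: card_cartesian_product)
qed

lemma card_crossing_arcs_le:
  assumes "finite B"
  shows "card {f \<in> block_arcs B. chords_cross e f} \<le> 2"
proof -
  have "card {f \<in> block_arcs B. chords_cross e f} \<le> card {f \<in> block_chords B. chords_cross e f}"
    using assms block_arcs_subset_chords by (intro card_mono) auto
  with card_crossing_chords_le[OF assms] show ?thesis by (meson le_trans)
qed

lemma cross_count_arcs_le:
  assumes "finite B" "finite C"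
  shows "cross_count (block_arcs B) (block_arcs C) \<le> 2 * (card B - 1)"
proof -
  have "cross_count (block_arcs B) (block_arcs C) \<le> (\<Sum>e\<in>block_arcs B. 2)"
    using assms card_crossing_arcs_le by (simp only: cross_count_eq_sum finite_block_arcs) (intro sum_mono, auto)
  with card_block_arcs_le[OF assms(1)] show ?thesis by simp
qed

text \<open>For linear arcs the estimate of two crossings per arc loses at least one: the block that
  starts first has an arc from its minimum, and no arc of the other block reaches over that end.
  This saving matters for blocks of equal size.\<close>

lemma cross_count_arcs_less:
  assumes fin: "finite B" "finite C" and B: "2 \<le> card B" and less: "Min B < Min C"
  shows "cross_count (block_arcs B) (block_arcs C) \<le> 2 * (card B - 1) - 1"
proof -
  let ?F = "\<lambda>e. card {f \<in> block_arcs C. chords_cross e f}"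
  let ?m = "Min B"
  have count: "cross_count (block_arcs B) (block_arcs C) = (\<Sum>e\<in>block_arcs B. ?F e)"
    using fin by (simp add: cross_count_eq_sum)
  have "card {?m} < card B" using B by simp
  then have ne: "B - {?m} \<noteq> {}"
    using fin by (metis Diff_eq_empty_iff card_mono finite.emptyI finite.insertI leD)
  define y where "y = Min (B - {?m})"
  have "y \<in> B - {?m}" unfolding y_def using ne fin by (intro Min_in) auto
  moreover have "\<not> k < y" if "k \<in> B" "?m < k" for k
    using that fin by (simp add: not_less y_def)
  moreover have "?m \<in> B" using ne fin by (intro Min_in) auto
  moreover have "?m \<le> y" using calculation fin by auto
  ultimately have y: "(?m, y) \<in> block_arcs B"
    unfolding block_arcs_def by fastforce
  have "Min C \<le> fst f" if "f \<in> block_arcs C" for f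
    using that fin by (auto simp: block_arcs_def)
  then have "{f \<in> block_arcs C. chords_cross (?m, y) f} \<subseteq> {f \<in> block_arcs C. fst f < y \<and> y < snd f}"
    using less by (fastforce simp: chords_cross_def)
  then have "?F (?m, y) \<le> card {f \<in> block_arcs C. fst f < y \<and> y < snd f}"
    using fin by (intro card_mono) auto
  also have "\<dots> \<le> 1" using card_arcs_straddling_le fin by blast
  finally have "?F (?m, y) \<le> 1" .
  moreover have "(\<Sum>e\<in>block_arcs B - {(?m, y)}. ?F e) \<le> (\<Sum>e\<in>block_arcs B - {(?m, y)}. 2)"
    using card_crossing_arcs_le fin by (intro sum_mono) auto
  moreover have "(\<Sum>e\<in>block_arcs B. ?F e) = ?F (?m, y) + (\<Sum>e\<in>block_arcs B - {(?m, y)}. ?F e)"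
    using y fin by (simp add: sum.remove)
  moreover have "card (block_arcs B - {(?m, y)}) = card (block_arcs B) - 1"
    using y by (simp add: card_Diff_singleton)
  moreover have "0 < card (block_arcs B)" using y fin by (auto simp: card_gt_0_iff)
  ultimately have "cross_count (block_arcs B) (block_arcs C) \<le> 2 * card (block_arcs B) - 1"
    using count by simp
  with card_block_arcs_le[OF fin(1)] show ?thesis by linarith
qed

section \<open>Weights on pairs of blocks\<close>

text \<open>The single weights are doubled because the second sum counts each unordered pair twice.\<close>

definition pair_weight :: "('a \<Rightarrow> int) \<Rightarrow> ('a \<Rightarrow> 'a \<Rightarrow> int) \<Rightarrow> 'a set \<Rightarrow> int" where
  "pair_weight w v I = 2 * (\<Sum>i\<in>I. w i) + (\<Sum>i\<in>I. \<Sum>j\<in>I - {i}. v i j)"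

lemma pair_weight_insert:
  assumes "finite I" "x \<notin> I" and sym: "\<And>i j. v i j = v j i"
  shows "pair_weight w v (insert x I) = pair_weight w v I + 2 * w x + 2 * (\<Sum>j\<in>I. v x j)"
proof -
  have "(\<Sum>i\<in>I. \<Sum>j\<in>insert x I - {i}. v i j) = (\<Sum>i\<in>I. v i x + (\<Sum>j\<in>I - {i}. v i j))"
  proof (rule sum.cong[OF refl])
    fix i assume "i \<in> I"
    then have "insert x I - {i} = insert x (I - {i})" using assms by auto
    then show "(\<Sum>j\<in>insert x I - {i}. v i j) = v i x + (\<Sum>j\<in>I - {i}. v i j)"
      using assms by simp
  qed
  also have "\<dots> = (\<Sum>j\<in>I. v x j) + (\<Sum>i\<in>I. \<Sum>j\<in>I - {i}. v i j)"
    using sym[of _ x] by (simp add: sum.distrib)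
  finally show ?thesis
    using assms by (simp add: pair_weight_def)
qed

lemma pair_weight_remove:
  assumes "finite I" "x \<in> I" and sym: "\<And>i j. v i j = v j i"
  shows "pair_weight w v I = pair_weight w v (I - {x}) + 2 * w x + 2 * (\<Sum>j\<in>I - {x}. v x j)"
  using pair_weight_insert[of "I - {x}" x v w] assms by (simp add: insert_absorb)

text \<open>Let \<open>S\<close> be the set of indices that may have weight \<open>-2\<close>. Any two of them bring a pair weight of at
  least \<open>2\<close>, and with \<open>s\<close> of them the total over ordered pairs is at least
  \<open>2(s\<^sup>2 - 3s)\<close>, which for integers never falls below \<open>-4\<close>. The term with \<open>\<kappa>\<close> records what pairs
  with exactly one index in \<open>S\<close> add.\<close>

lemma pair_weight_ge:
  fixes S :: "'a set" and \<kappa> :: int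
  assumes "finite I" and sym: "\<And>i j. v i j = v j i" and "\<kappa> \<ge> 0"
    and w_small: "\<And>i. i \<in> I \<Longrightarrow> i \<in> S \<Longrightarrow> w i \<ge> -2"
    and w_large: "\<And>i. i \<in> I \<Longrightarrow> i \<notin> S \<Longrightarrow> w i \<ge> 0"
    and v_small: "\<And>i j. i \<in> I \<Longrightarrow> j \<in> I \<Longrightarrow> i \<noteq> j \<Longrightarrow> i \<in> S \<Longrightarrow> j \<in> S \<Longrightarrow> v i j \<ge> 2"
    and v_mixed: "\<And>i j. i \<in> I \<Longrightarrow> j \<in> I \<Longrightarrow> i \<in> S \<Longrightarrow> j \<notin> S \<Longrightarrow> v i j \<ge> \<kappa>"
    and v_large: "\<And>i j. i \<in> I \<Longrightarrow> j \<in> I \<Longrightarrow> i \<noteq> j \<Longrightarrow> i \<notin> S \<Longrightarrow> j \<notin> S \<Longrightarrow> v i j \<ge> 0"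
  defines "s \<equiv> \<lambda>I. int (card (I \<inter> S))" and "l \<equiv> \<lambda>I. int (card (I - S))"
  shows "pair_weight w v I \<ge> 2 * ((s I)\<^sup>2 - 3 * s I + \<kappa> * s I * l I)"
proof -
  have "pair_weight w v J \<ge> 2 * ((s J)\<^sup>2 - 3 * s J + \<kappa> * s J * l J)" if "finite J" "J \<subseteq> I" for J
    using that
  proof (induction J rule: finite_induct)
    case empty
    then show ?case by (simp add: pair_weight_def s_def)
  next
    case (insert x J)
    note step = pair_weight_insert[OF insert.hyps(1,2) sym, of w]
    have split: "(\<Sum>j\<in>J. v x j) = (\<Sum>j\<in>J \<inter> S. v x j) + (\<Sum>j\<in>J - S. v x j)"
      using insert.hyps by (metis sum.Int_Diff)
    have IH: "pair_weight w v J \<ge> 2 * ((s J)\<^sup>2 - 3 * s J + \<kappa> * s J * l J)"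
      using insert by simp
    show ?case
    proof (cases "x \<in> S")
      case True
      have "s (insert x J) = s J + 1" "l (insert x J) = l J"
        using True insert.hyps by (simp_all add: s_def l_def)
      moreover have "(\<Sum>j\<in>J \<inter> S. v x j) \<ge> (\<Sum>j\<in>J \<inter> S. 2)"
        using insert.prems insert.hyps True by (intro sum_mono v_small) auto
      moreover have "(\<Sum>j\<in>J - S. v x j) \<ge> (\<Sum>j\<in>J - S. \<kappa>)"
        using insert.prems True by (intro sum_mono v_mixed) auto
      moreover have "w x \<ge> -2" using insert.prems True w_small by simp
      ultimately show ?thesis using step split IH
        by (simp add: s_def l_def power2_eq_square algebra_simps)
    next
      case False
      have "s (insert x J) = s J" "l (insert x J) = l J + 1"
        using False insert.hyps by (simp_all add: s_def l_def insert_Diff_if)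
      moreover have "(\<Sum>j\<in>J \<inter> S. v x j) \<ge> (\<Sum>j\<in>J \<inter> S. \<kappa>)"
        using insert.prems insert.hyps False by (intro sum_mono) (metis IntE insertCI subsetD sym v_mixed)
      moreover have "(\<Sum>j\<in>J - S. v x j) \<ge> 0"
        using insert.prems insert.hyps False by (intro sum_nonneg v_large) auto
      moreover have "w x \<ge> 0" using insert.prems False w_large by simp
      ultimately show ?thesis using step split IH
        by (simp add: s_def l_def power2_eq_square algebra_simps)
    qed
  qed
  then show ?thesis using \<open>finite I\<close> by blast
qed

text \<open>Squaring the sum of the sizes turns an estimate for \<open>N\<close> in terms of \<open>n = \<Sum>b i\<close> into a statement
  about blocks and pairs of blocks. The weights vanish for blocks of size three that cross as often
  as possible (\<open>c = 6\<close> with \<open>N = 3\<close>, \<open>c = 3\<close> with \<open>N = 6\<close>), the shape of the extremal partitions.\<close>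

lemma pair_weight_sizes:
  fixes b :: "'a \<Rightarrow> int" and N :: "'a \<Rightarrow> 'a \<Rightarrow> int"
  assumes "finite I"
  shows "pair_weight (\<lambda>i. b i * (b i - 3)) (\<lambda>i j. 2 * b i * b j - c * N i j) I
       = 2 * ((\<Sum>i\<in>I. b i)\<^sup>2 - 3 * (\<Sum>i\<in>I. b i)) - c * (\<Sum>i\<in>I. \<Sum>j\<in>I - {i}. N i j)"
proof -
  have "(\<Sum>i\<in>I. b i)\<^sup>2 = (\<Sum>i\<in>I. \<Sum>j\<in>I. b i * b j)"
    by (simp add: power2_eq_square sum_product)
  also have "\<dots> = (\<Sum>i\<in>I. b i * b i + (\<Sum>j\<in>I - {i}. b i * b j))"
    by (intro sum.cong refl sum.remove assms)
  finally have "(\<Sum>i\<in>I. b i)\<^sup>2 = (\<Sum>i\<in>I. b i * b i) + (\<Sum>i\<in>I. \<Sum>j\<in>I - {i}. b i * b j)"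
    by (simp add: sum.distrib)
  moreover have "(\<Sum>i\<in>I. b i * (b i - 3)) = (\<Sum>i\<in>I. b i * b i) - 3 * (\<Sum>i\<in>I. b i)"
    by (simp add: right_diff_distrib sum_subtractf flip: sum_distrib_right)
  moreover have "(\<Sum>i\<in>I. \<Sum>j\<in>I - {i}. 2 * b i * b j - c * N i j)
      = 2 * (\<Sum>i\<in>I. \<Sum>j\<in>I - {i}. b i * b j) - c * (\<Sum>i\<in>I. \<Sum>j\<in>I - {i}. N i j)"
    by (simp add: sum_subtractf sum_distrib_left mult.assoc)
  ultimately show ?thesis
    by (simp add: pair_weight_def)
qed

lemma consecutive_product_nonneg: "(a - k) * (a - k - 1) \<ge> 0" for a k :: int
  by (cases "a \<le> k") (auto intro: mult_nonpos_nonpos mult_nonneg_nonneg)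

section \<open>Crossings of a partition, pair by pair\<close>

lemma partition_facts:
  assumes "partition_on {1..n} P"
  shows "finite P" "\<And>B. B \<in> P \<Longrightarrow> finite B" "\<And>B. B \<in> P \<Longrightarrow> card B > 0"
    and "\<And>B C. B \<in> P \<Longrightarrow> C \<in> P \<Longrightarrow> B \<noteq> C \<Longrightarrow> B \<inter> C = {}"
    and "(\<Sum>B\<in>P. card B) = n"
proof -
  show fin: "finite P" using assms finite_elements by blast
  show finB: "finite B" if "B \<in> P" for B
    using assms that by (metis finite_atLeastAtMost finite_subset partition_onD1 Union_upper)
  show "card B > 0" if "B \<in> P" for B
    using finB[OF that] that assms partition_onD3 by (metis card_gt_0_iff)
  show disj: "B \<inter> C = {}" if "B \<in> P" "C \<in> P" "B \<noteq> C" for B C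
    using assms that by (meson disjointD partition_onD2)
  have "card (\<Union>P) = (\<Sum>B\<in>P. card B)"
    using finB disj by (intro card_Union_disjoint) (auto simp: pairwise_def disjnt_def)
  then show "(\<Sum>B\<in>P. card B) = n" using assms by (simp add: partition_onD1[symmetric])
qed

lemma double_crossings_partition:
  assumes P: "partition_on {1..n} P"
    and D: "\<And>B. B \<in> P \<Longrightarrow> D B \<subseteq> block_chords B"
  shows "2 * crossings (\<Union>B\<in>P. D B) = (\<Sum>B\<in>P. \<Sum>C\<in>P - {B}. cross_count (D B) (D C))"
proof -
  note facts = partition_facts[OF P]
  have fin: "finite (D B)" if "B \<in> P" for B
    using D[OF that] facts(2)[OF that] finite_subset by (metis finite_block_chords)
  have disj: "D B \<inter> D C = {}" if "B \<in> P" "C \<in> P" "B \<noteq> C" for B C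
  proof -
    have "D B \<subseteq> B \<times> B" "D C \<subseteq> C \<times> C"
      using D block_chords_subset facts(2) that by (meson subset_trans)+
    then show ?thesis using facts(4)[OF that] by fast
  qed
  have "2 * crossings (\<Union>B\<in>P. D B) = (\<Sum>B\<in>P. \<Sum>C\<in>P. cross_count (D B) (D C))"
    using fin disj facts(1) by (simp add: double_crossings cross_count_UN)
  also have "\<dots> = (\<Sum>B\<in>P. \<Sum>C\<in>P - {B}. cross_count (D B) (D C))"
  proof (rule sum.cong[OF refl])
    fix B assume B: "B \<in> P"
    have "cross_count (D B) (D B) \<le> cross_count (block_chords B) (block_chords B)"
      using D facts(2) B by (intro cross_count_mono) auto
    then have "cross_count (D B) (D B) = 0"
      using cross_count_same_block facts(2) B by simp
    then show "(\<Sum>C\<in>P. cross_count (D B) (D C)) = (\<Sum>C\<in>P - {B}. cross_count (D B) (D C))"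
      using sum.remove[OF facts(1) B, of "\<lambda>C. cross_count (D B) (D C)"] by simp
  qed
  finally show ?thesis .
qed

section \<open>Upper bound for linear crossings\<close>

text \<open>For \<open>b < c\<close> the bound \<open>N \<le> 2b - 2\<close> gives a pair weight of at least \<open>2(b - 2)(b - 3)\<close>, and for \<open>b = c \<ge> 2\<close>
  the bound \<open>N \<le> 2b - 3\<close> gives at least \<open>2(b - 3)\<^sup>2\<close>.\<close>

lemma linear_pair_bounds:
  assumes "finite B" "finite C" "card B > 0" "card C > 0" "B \<inter> C = {}"
  defines "N \<equiv> int (cross_count (block_arcs B) (block_arcs C))"
    and "b \<equiv> int (card B)" and "c \<equiv> int (card C)"
  shows "0 \<le> 2 * b * c - 6 * N"
    and "b \<le> 2 \<Longrightarrow> c \<le> 2 \<Longrightarrow> 2 \<le> 2 * b * c - 6 * N"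
proof -
  have pos: "b \<ge> 1" "c \<ge> 1" using assms by (simp_all add: b_def c_def)
  have Nb: "N \<le> 2 * b - 2"
    using cross_count_arcs_le[OF assms(1,2)] assms(3) by (simp add: N_def b_def)
  have Nc: "N \<le> 2 * c - 2"
    using cross_count_arcs_le[OF assms(2,1)] assms(4)
    by (simp add: N_def c_def cross_count_commute)
  have Neq: "N \<le> 2 * b - 3" if "b = c" "b \<ge> 2"
  proof -
    have "Min B \<in> B" "Min C \<in> C" using assms by (auto intro!: Min_in)
    then have "Min B \<noteq> Min C" using assms(5) by auto
    then consider "Min B < Min C" | "Min C < Min B" by linarith
    then show ?thesis
    proof cases
      case 1
      then show ?thesis
        using cross_count_arcs_less[OF assms(1,2)] that by (simp add: N_def b_def)
    next
      case 2
      then show ?thesis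
        using cross_count_arcs_less[OF assms(2,1)] that
        by (simp add: N_def b_def c_def cross_count_commute)
    qed
  qed
  have N0: "N = 0" if "b = 1 \<or> c = 1"
    using that Nb Nc by (auto simp: N_def)
  \<comment> \<open>\<open>2x(x+1) - 6(2x-2) = 2(x-2)(x-3)\<close>, nonnegative since \<open>x\<close> is an integer.\<close>
  have unequal: "0 \<le> 2 * x * y - 6 * N" if "x < y" "x \<ge> 1" "N \<le> 2 * x - 2" for x y
  proof -
    have "x * (x + 1) \<le> x * y" using that by (intro mult_left_mono) auto
    moreover have "(x - 2) * (x - 2 - 1) \<ge> 0" by (rule consecutive_product_nonneg)
    ultimately show ?thesis using that(3) by (simp add: algebra_simps)
  qed
  \<comment> \<open>\<open>2b\<^sup>2 - 6(2b-3) = 2(b-3)\<^sup>2\<close>.\<close>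
  have square: "2 * (b - 3)\<^sup>2 \<le> 2 * b * c - 6 * N" if "b = c" "b \<ge> 2"
    using Neq[OF that] that by (simp add: power2_eq_square algebra_simps)
  show "0 \<le> 2 * b * c - 6 * N"
  proof (cases b c rule: linorder_cases)
    case equal
    show ?thesis
    proof (cases "b = 1")
      case True
      then show ?thesis using N0 pos by simp
    next
      case False
      then show ?thesis using square equal pos zero_le_power2[of "b - 3"] by linarith
    qed
  next
    case less
    then show ?thesis using unequal[of b c] pos Nb by simp
  next
    case greater
    then show ?thesis using unequal[of c b] pos Nc by (simp add: mult.assoc mult.commute)
  qed
  show "2 \<le> 2 * b * c - 6 * N" if "b \<le> 2" "c \<le> 2"
  proof -
    have "b = 1 \<or> b = 2" "c = 1 \<or> c = 2" using that pos by auto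
    then show ?thesis using N0 Neq by fastforce
  qed
qed

lemma crossings_pair_weight:
  assumes P: "partition_on {1..n} P"
    and D: "\<And>B. B \<in> P \<Longrightarrow> D B \<subseteq> block_chords B"
  defines "b \<equiv> \<lambda>B. int (card B)"
  shows "pair_weight (\<lambda>B. b B * (b B - 3)) (\<lambda>B C. 2 * b B * b C - k * int (cross_count (D B) (D C))) P
       = 2 * ((int n)\<^sup>2 - 3 * int n) - 2 * k * int (crossings (\<Union>B\<in>P. D B))"
proof -
  have "(\<Sum>B\<in>P. b B) = int n"
    using partition_facts(5)[OF P] by (simp add: b_def flip: of_nat_sum)
  moreover have "(\<Sum>B\<in>P. \<Sum>C\<in>P - {B}. int (cross_count (D B) (D C))) = 2 * int (crossings (\<Union>B\<in>P. D B))"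
    using arg_cong[OF double_crossings_partition[OF P D], of int] by simp
  ultimately show ?thesis
    using pair_weight_sizes[OF partition_facts(1)[OF P], of b k "\<lambda>B C. int (cross_count (D B) (D C))"]
    by simp
qed

text \<open>With \<open>T\<close> crossings the pair weight of the partition is \<open>2(n\<^sup>2 - 3n) - 12T\<close>, so the claim says exactly
  that this weight is at least \<open>-4\<close>. Only blocks of size one or two have negative weight.\<close>

lemma cr_linear_le:
  assumes P: "partition_on {1..n} P"
  shows "6 * int (cr_linear P) \<le> (int n - 1) * (int n - 2)"
proof -
  note facts = partition_facts[OF P]
  define b where "b B = int (card B)" for B :: "nat set"
  define v where "v = (\<lambda>B C. 2 * b B * b C - 6 * int (cross_count (block_arcs B) (block_arcs C)))"
  let ?S = "{B. card B \<le> 2}"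
  let ?s = "int (card (P \<inter> ?S))"
  have weight: "pair_weight (\<lambda>B. b B * (b B - 3)) v P
      = 2 * ((int n)\<^sup>2 - 3 * int n) - 12 * int (cr_linear P)"
    using crossings_pair_weight[OF P, of block_arcs 6] block_arcs_subset_chords
    by (simp add: b_def v_def cr_linear_def linear_arcs_def)
  have "pair_weight (\<lambda>B. b B * (b B - 3)) v P \<ge> 2 * (?s\<^sup>2 - 3 * ?s + 0 * ?s * int (card (P - ?S)))"
  proof (rule pair_weight_ge)
    show "finite P" by (rule facts)
    show "v B C = v C B" for B C by (simp add: v_def cross_count_commute)
    show "b B * (b B - 3) \<ge> -2" for B
      using consecutive_product_nonneg[of "b B" 1] by (simp add: algebra_simps)
    show "b B * (b B - 3) \<ge> 0" if "B \<notin> ?S" for B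
      using that by (simp add: b_def)
    show "v B C \<ge> 2" if "B \<in> P" "C \<in> P" "B \<noteq> C" "B \<in> ?S" "C \<in> ?S" for B C
      using linear_pair_bounds(2)[of B C] facts that by (simp add: v_def b_def)
    show "v B C \<ge> 0" if "B \<in> P" "C \<in> P" "B \<noteq> C" for B C
      using linear_pair_bounds(1)[of B C] facts that by (simp add: v_def b_def)
    then show "v B C \<ge> 0" if "B \<in> P" "C \<in> P" "B \<in> ?S" "C \<notin> ?S" for B C
      using that by metis
  qed simp_all
  moreover have "?s\<^sup>2 - 3 * ?s \<ge> -2"
    using consecutive_product_nonneg[of ?s 1] by (simp add: power2_eq_square algebra_simps)
  ultimately show ?thesis using weight by (simp add: power2_eq_square algebra_simps)
qed

section \<open>Upper bounds for circular crossings\<close>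

lemma circular_pair_bounds:
  assumes "finite B" "finite C" "card B > 0" "card C > 0"
  defines "N \<equiv> int (cross_count (block_chords B) (block_chords C))"
    and "b \<equiv> int (card B)" and "c \<equiv> int (card C)"
  shows "b = 1 \<Longrightarrow> N = 0" and "b = 2 \<Longrightarrow> N \<le> 2" and "b = 2 \<Longrightarrow> c \<le> 2 \<Longrightarrow> N \<le> 1"
    and "N \<le> 2 * b" and "N \<le> 2 * c"
proof -
  have chords: "card (block_chords B) \<le> (if 3 \<le> card B then card B else card B - 1)"
    "card (block_chords C) \<le> (if 3 \<le> card C then card C else card C - 1)"
    using assms card_block_chords_le by blast+
  have NB: "cross_count (block_chords B) (block_chords C) \<le> 2 * card (block_chords B)"
    using assms cross_count_chords_le by blast
  have NC: "cross_count (block_chords B) (block_chords C) \<le> 2 * card (block_chords C)"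
    using assms cross_count_chords_le cross_count_commute by metis
  show "b = 1 \<Longrightarrow> N = 0" "b = 2 \<Longrightarrow> N \<le> 2" "N \<le> 2 * b" "N \<le> 2 * c"
    using chords NB NC unfolding N_def b_def c_def by (auto split: if_splits)
  have prod: "cross_count (block_chords B) (block_chords C) \<le> card (block_chords B) * card (block_chords C)"
    using assms by (simp add: cross_count_le_prod)
  show "N \<le> 1" if "b = 2" "c \<le> 2"
  proof -
    have "card (block_chords B) * card (block_chords C) \<le> 1 * 1"
      using chords that by (intro mult_le_mono) (auto simp: b_def c_def)
    with prod show ?thesis by (simp add: N_def)
  qed
qed

text \<open>The bounds \<open>2c\<close> apply to pairs with one block of size other than three. Summed over the partners of
  that block they give the gap of order \<open>2n\<close> between the two upper bounds on three times the number
  of circular crossings.\<close>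

lemma circular_pair_weight_bounds:
  assumes "finite B" "finite C" "card B > 0" "card C > 0"
  defines "b \<equiv> int (card B)" and "c \<equiv> int (card C)"
  defines "v \<equiv> 2 * b * c - 3 * int (cross_count (block_chords B) (block_chords C))"
  shows "b = 1 \<Longrightarrow> v = 2 * c"
    and "b = 2 \<Longrightarrow> v \<ge> 2 * c" and "b = 2 \<Longrightarrow> c = 2 \<Longrightarrow> v \<ge> 2 * c + 1"
    and "b \<le> 2 \<Longrightarrow> c \<le> 2 \<Longrightarrow> v \<ge> 2"
    and "b \<le> 2 \<Longrightarrow> c \<ge> 3 \<Longrightarrow> v \<ge> 6"
    and "b \<ge> 3 \<Longrightarrow> c \<ge> 3 \<Longrightarrow> v \<ge> 0"
    and "b \<ge> 4 \<Longrightarrow> c \<ge> 3 \<Longrightarrow> v \<ge> 2 * c"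
proof -
  have pos: "b \<ge> 1" "c \<ge> 1" using assms by (simp_all add: b_def c_def)
  note bounds = circular_pair_bounds[OF assms(1-4), folded b_def c_def]
  show b1: "b = 1 \<Longrightarrow> v = 2 * c" using bounds(1) by (simp add: v_def)
  have b2: "b = 2 \<Longrightarrow> v \<ge> 4 * c - 6" "b = 2 \<Longrightarrow> c \<le> 2 \<Longrightarrow> v \<ge> 4 * c - 3"
    using bounds(2,3) by (simp_all add: v_def)
  show "b = 2 \<Longrightarrow> v \<ge> 2 * c" "b = 2 \<Longrightarrow> c = 2 \<Longrightarrow> v \<ge> 2 * c + 1"
  proof -
    have "c = 1 \<Longrightarrow> v = 4" if "b = 2"
      using circular_pair_bounds(1)[OF assms(2,1,4,3)] that
      by (simp add: v_def c_def b_def cross_count_commute)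
    then show "b = 2 \<Longrightarrow> v \<ge> 2 * c" "b = 2 \<Longrightarrow> c = 2 \<Longrightarrow> v \<ge> 2 * c + 1"
      using b2 pos by (cases "c \<ge> 3"; linarith)+
  qed
  then show "b \<le> 2 \<Longrightarrow> c \<le> 2 \<Longrightarrow> v \<ge> 2" using b1 pos by (cases "b = 1") auto
  show "b \<le> 2 \<Longrightarrow> c \<ge> 3 \<Longrightarrow> v \<ge> 6" using b1 b2 pos by (cases "b = 1") auto
  have prod: "v \<ge> 2 * b * (c - 3)" "v \<ge> 2 * c * (b - 3)"
    using bounds(4,5) by (simp_all add: v_def algebra_simps)
  show "b \<ge> 3 \<Longrightarrow> c \<ge> 3 \<Longrightarrow> v \<ge> 0"
    using prod(1) by (smt (verit) mult_nonneg_nonneg)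
  show "b \<ge> 4 \<Longrightarrow> c \<ge> 3 \<Longrightarrow> v \<ge> 2 * c"
  proof -
    assume "b \<ge> 4" "c \<ge> 3"
    then have "2 * c * 1 \<le> 2 * c * (b - 3)" by (intro mult_left_mono) auto
    then show ?thesis using prod(2) by simp
  qed
qed

definition circular_weight :: "nat set set \<Rightarrow> int" where
  "circular_weight = pair_weight (\<lambda>B. int (card B) * (int (card B) - 3))
     (\<lambda>B C. 2 * int (card B) * int (card C) - 3 * int (cross_count (block_chords B) (block_chords C)))"

lemma circular_weight_eq:
  assumes P: "partition_on {1..n} P"
  shows "circular_weight P = 2 * ((int n)\<^sup>2 - 3 * int n) - 6 * int (cr_circular P)"
  using crossings_pair_weight[OF P, of block_chords 3]
  by (simp add: circular_weight_def cr_circular_def circular_chords_def)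

lemma circular_weight_ge:
  assumes "finite Q" and blocks: "\<And>B. B \<in> Q \<Longrightarrow> finite B \<and> card B > 0"
  defines "s \<equiv> int (card {B \<in> Q. card B \<le> 2})" and "l \<equiv> int (card {B \<in> Q. card B \<ge> 3})"
  shows "circular_weight Q \<ge> 2 * (s\<^sup>2 - 3 * s + 6 * s * l)"
proof -
  let ?S = "{B. card B \<le> 2}"
  have "Q \<inter> ?S = {B \<in> Q. card B \<le> 2}" "Q - ?S = {B \<in> Q. card B \<ge> 3}" by auto
  then have sl: "s = int (card (Q \<inter> ?S))" "l = int (card (Q - ?S))"
    by (simp_all add: s_def l_def)
  note bounds = circular_pair_weight_bounds
  show ?thesis unfolding circular_weight_def sl
  proof (rule pair_weight_ge)
    show "finite Q" by fact
    fix B C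
    show "2 * int (card B) * int (card C) - 3 * int (cross_count (block_chords B) (block_chords C))
        = 2 * int (card C) * int (card B) - 3 * int (cross_count (block_chords C) (block_chords B))"
      by (simp add: cross_count_commute)
    show "int (card B) * (int (card B) - 3) \<ge> -2"
      using consecutive_product_nonneg[of "int (card B)" 1] by (simp add: algebra_simps)
    show "int (card B) * (int (card B) - 3) \<ge> 0" if "B \<notin> ?S"
      using that by simp
    show "2 \<le> 2 * int (card B) * int (card C) - 3 * int (cross_count (block_chords B) (block_chords C))"
      if "B \<in> Q" "C \<in> Q" "B \<in> ?S" "C \<in> ?S"
      using bounds(4)[of B C] blocks that by simp
    show "6 \<le> 2 * int (card B) * int (card C) - 3 * int (cross_count (block_chords B) (block_chords C))"
      if "B \<in> Q" "C \<in> Q" "B \<in> ?S" "C \<notin> ?S"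
      using bounds(5)[of B C] blocks that by simp
    show "0 \<le> 2 * int (card B) * int (card C) - 3 * int (cross_count (block_chords B) (block_chords C))"
      if "B \<in> Q" "C \<in> Q" "B \<notin> ?S" "C \<notin> ?S"
      using bounds(6)[of B C] blocks that by simp
  qed simp
qed

lemma circular_weight_ge_minus4:
  assumes "finite Q" and "\<And>B. B \<in> Q \<Longrightarrow> finite B \<and> card B > 0"
  shows "circular_weight Q \<ge> -4"
proof -
  define s l where "s = int (card {B \<in> Q. card B \<le> 2})" and "l = int (card {B \<in> Q. card B \<ge> 3})"
  have "s \<ge> 0" "l \<ge> 0" by (simp_all add: s_def l_def)
  then have "s * l \<ge> 0" by simp
  moreover have "(s - 1) * (s - 1 - 1) \<ge> 0" by (rule consecutive_product_nonneg)
  moreover have "circular_weight Q \<ge> 2 * (s\<^sup>2 - 3 * s + 6 * s * l)"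
    unfolding s_def l_def by (rule circular_weight_ge[OF assms])
  ultimately show ?thesis by (simp add: power2_eq_square algebra_simps)
qed

lemma cr_circular_le:
  assumes P: "partition_on {1..n} P"
  shows "3 * int (cr_circular P) \<le> (int n - 1) * (int n - 2)"
proof -
  have "circular_weight P \<ge> -4"
    using partition_facts[OF P] by (intro circular_weight_ge_minus4) auto
  then show ?thesis
    using circular_weight_eq[OF P] by (simp add: power2_eq_square algebra_simps)
qed

text \<open>The circular weight must be shown to be at least \<open>4n - 12\<close>. A block \<open>X\<close> of size other than three
  is split off, and its pairs with the other blocks alone contribute at least \<open>4(n - card X)\<close>. If there
  are blocks of size one or two, \<open>X\<close> is a smallest block. For a singleton the general bound \<open>-4\<close> on the
  weight of the rest suffices. For a block of size two, further blocks of size two are compensated by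
  their pairs with \<open>X\<close>, with each other and with larger blocks; the only exception is a partition into
  just two blocks of size two, excluded by \<open>n \<ge> 5\<close>. If all blocks have size at least three, the
  weight of the rest is nonnegative.\<close>

lemma cr_circular_le_not_all_triples:
  assumes P: "partition_on {1..n} P" and n: "n \<ge> 5" and not3: "\<exists>B\<in>P. card B \<noteq> 3"
  shows "3 * int (cr_circular P) \<le> (int n - 2) * (int n - 3)"
proof -
  note facts = partition_facts[OF P]
  define v where "v B C = 2 * int (card B) * int (card C)
     - 3 * int (cross_count (block_chords B) (block_chords C))" for B C
  note bounds = circular_pair_weight_bounds[folded v_def]
  have remove: "circular_weight P = circular_weight (P - {X})
      + 2 * (int (card X) * (int (card X) - 3)) + 2 * (\<Sum>C\<in>P - {X}. v X C)" if "X \<in> P" for X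
    unfolding circular_weight_def v_def
    by (rule pair_weight_remove[OF facts(1) that]) (simp add: cross_count_commute)
  have rest: "(\<Sum>C\<in>P - {X}. 2 * int (card C)) = 2 * (int n - int (card X))" if "X \<in> P" for X
  proof -
    have "int n = int (card X) + (\<Sum>C\<in>P - {X}. int (card C))"
      using arg_cong[OF facts(5), of int] sum.remove[OF facts(1) that, of "\<lambda>C. int (card C)"] by simp
    then show ?thesis by (simp flip: sum_distrib_left)
  qed
  let ?s = "\<lambda>Q. int (card {B \<in> Q. card B \<le> 2})" and ?l = "\<lambda>Q. int (card {B \<in> Q. card B \<ge> 3})"
  have weight: "circular_weight (P - {X}) \<ge> 2 * ((?s (P - {X}))\<^sup>2 - 3 * ?s (P - {X}) + 6 * ?s (P - {X}) * ?l (P - {X}))" for X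
    using facts by (intro circular_weight_ge) auto
  have "circular_weight P \<ge> 4 * int n - 12"
  proof -
    consider (one) X where "X \<in> P" "card X = 1"
      | (two) X where "X \<in> P" "card X = 2" "\<forall>B\<in>P. card B \<ge> 2"
      | (four) X where "X \<in> P" "card X \<ge> 4" "\<forall>B\<in>P. card B \<ge> 3"
    proof -
      have small: "card B = 1 \<or> card B = 2 \<or> card B = 3 \<or> card B \<ge> 4" if "B \<in> P" for B
        using facts(3)[OF that] by linarith
      show thesis
      proof (cases "\<exists>B\<in>P. card B = 1")
        case True
        then show thesis using one by blast
      next
        case no1: False
        show thesis
        proof (cases "\<exists>B\<in>P. card B = 2")
          case True
          moreover have "\<forall>B\<in>P. card B \<ge> 2" using small no1 by fastforce
          ultimately show thesis using two by blast
        next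
          case False
          then have "\<forall>B\<in>P. card B \<ge> 3" using small no1 by fastforce
          moreover from this not3 obtain X where "X \<in> P" "card X \<ge> 4"
            using small no1 False by blast
          ultimately show thesis using four by blast
        qed
      qed
    qed
    then show ?thesis
    proof cases
      case one
      have "(\<Sum>C\<in>P - {X}. v X C) = (\<Sum>C\<in>P - {X}. 2 * int (card C))"
        using bounds(1)[of X] facts one by (intro sum.cong) auto
      moreover have "circular_weight (P - {X}) \<ge> -4"
        using facts by (intro circular_weight_ge_minus4) auto
      ultimately show ?thesis
        using remove[OF one(1)] rest[OF one(1)] one(2) by simp
    next
      case two
      let ?t = "?s (P - {X})"
      have "(\<Sum>C\<in>P - {X}. 2 * int (card C) + of_bool (card C \<le> 2)) \<le> (\<Sum>C\<in>P - {X}. v X C)"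
      proof (rule sum_mono)
        fix C assume "C \<in> P - {X}"
        then have "C \<in> P" "card C \<ge> 2" using two by auto
        then show "2 * int (card C) + of_bool (card C \<le> 2) \<le> v X C"
          using bounds(2,3)[of X C] facts two by (cases "card C = 2") auto
      qed
      moreover have "(\<Sum>C\<in>P - {X}. of_bool (card C \<le> 2)) = ?t"
        using facts(1) by (simp add: of_bool_def sum.If_cases Int_def)
      ultimately have sum: "(\<Sum>C\<in>P - {X}. v X C) \<ge> 2 * (int n - 2) + ?t"
        using rest[OF two(1)] two(2) by (simp add: sum.distrib)
      \<comment> \<open>For integers \<open>t, l \<ge> 0\<close> the product \<open>t (t - 2 + 6 l)\<close> is negative only if \<open>t = 1\<close> and \<open>l = 0\<close>.\<close>
      have "?t * (?t - 2 + 6 * ?l (P - {X})) \<ge> 0"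
      proof (cases "?t = 1 \<and> ?l (P - {X}) = 0")
        case False
        then consider "?t = 0" | "?t \<ge> 2" | "?t \<ge> 1" "?l (P - {X}) \<ge> 1" by linarith
        then show ?thesis by cases auto
      next
        case True
        then obtain Y where Y: "{B \<in> P - {X}. card B \<le> 2} = {Y}"
          by (metis card_1_singletonE of_nat_eq_1_iff)
        have "{B \<in> P - {X}. card B \<ge> 3} = {}" using True facts(1) by simp
        then have "P - {X} = {Y}" using Y by fastforce
        moreover have "card Y \<le> 2" using Y by blast
        ultimately have "n \<le> 4"
          using facts(5) sum.remove[OF facts(1) two(1), of card] two(2) by simp
        with n show ?thesis by simp
      qed
      then show ?thesis
        using weight[of X] remove[OF two(1)] sum two(2) by (simp add: power2_eq_square algebra_simps)
    next
      case four
      have "{B \<in> P - {X}. card B \<le> 2} = {}" using four(3) by fastforce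
      then have no_small: "?s (P - {X}) = 0" by (simp only: card.empty of_nat_0)
      have "circular_weight (P - {X}) \<ge> 0" using weight[of X] unfolding no_small by simp
      moreover have "(\<Sum>C\<in>P - {X}. v X C) \<ge> (\<Sum>C\<in>P - {X}. 2 * int (card C))"
        using bounds(7)[of X] facts four by (intro sum_mono) auto
      moreover have "(int (card X) - 2) * (int (card X) - 2 - 1) \<ge> 0"
        by (rule consecutive_product_nonneg)
      ultimately show ?thesis
        using remove[OF four(1)] rest[OF four(1)] by (simp add: algebra_simps)
    qed
  qed
  then show ?thesis
    using circular_weight_eq[OF P] by (simp add: power2_eq_square algebra_simps)
qed

lemma all_triples_dvd:
  fixes n :: nat
  assumes P: "partition_on {1..n} P" and "\<forall>B\<in>P. card B = 3"
  shows "n mod 3 = 0"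
proof -
  have "n = 3 * card P" using partition_facts(5)[OF P] assms(2) by simp
  then show ?thesis by simp
qed

section \<open>Partitions with many crossings\<close>

text \<open>The residue classes modulo \<open>d\<close> of \<open>{1..n}\<close>, written out for \<open>n \<le> 3d\<close>: for \<open>n \<ge> 2d\<close>, \<open>n - 2d\<close> of them
  are triples and the others have size two. The points of different classes alternate as much as
  possible.\<close>

definition ladder_block :: "nat \<Rightarrow> nat \<Rightarrow> nat \<Rightarrow> nat set" where
  "ladder_block n d r = {r, r + d, r + 2 * d} \<inter> {1..n}"

definition ladder :: "nat \<Rightarrow> nat \<Rightarrow> nat set set" where
  "ladder n d = ladder_block n d ` {1..d}"

lemma ladder_block_disjoint:
  assumes "r \<in> {1..d}" "s \<in> {1..d}" "r \<noteq> s"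
  shows "ladder_block n d r \<inter> ladder_block n d s = {}"
  using assms by (auto simp: ladder_block_def)

lemma ladder_partition:
  assumes "d \<le> n" "n \<le> 3 * d"
  shows "partition_on {1..n} (ladder n d)"
proof (rule partition_onI)
  show "\<Union> (ladder n d) = {1..n}"
  proof
    show "{1..n} \<subseteq> \<Union> (ladder n d)"
    proof
      fix x assume x: "x \<in> {1..n}"
      then consider "x \<in> {1..d}" | "x - d \<in> {1..d}" "x > d" | "x - 2 * d \<in> {1..d}" "x > 2 * d"
        using assms by fastforce
      then have "\<exists>r\<in>{1..d}. x \<in> ladder_block n d r"
      proof cases
        case 1
        then show ?thesis using x by (intro bexI[of _ x]) (auto simp: ladder_block_def)
      next
        case 2
        then show ?thesis using x by (intro bexI[of _ "x - d"]) (auto simp: ladder_block_def)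
      next
        case 3
        then show ?thesis using x by (intro bexI[of _ "x - 2 * d"]) (auto simp: ladder_block_def)
      qed
      then show "x \<in> \<Union> (ladder n d)" by (auto simp: ladder_def)
    qed
  qed (auto simp: ladder_def ladder_block_def)
  show "disjnt p q" if "p \<in> ladder n d" "q \<in> ladder n d" "p \<noteq> q" for p q
    using that ladder_block_disjoint by (fastforce simp: ladder_def disjnt_def)
  have "r \<in> ladder_block n d r" if "r \<in> {1..d}" for r
    using that assms by (auto simp: ladder_block_def)
  then show "{} \<notin> ladder n d"
    unfolding ladder_def by (metis (no_types) empty_iff imageE)
qed

lemma ladder_block_arcs:
  assumes "1 \<le> r" "d > 0"
  shows "r + d \<le> n \<Longrightarrow> (r, r + d) \<in> block_arcs (ladder_block n d r)"
    and "r + 2 * d \<le> n \<Longrightarrow> (r + d, r + 2 * d) \<in> block_arcs (ladder_block n d r)"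
  using assms by (auto simp: ladder_block_def block_arcs_def)

lemma ladder_block_closing_chord:
  assumes "1 \<le> r" "d > 0" "r + 2 * d \<le> n"
  shows "(r, r + 2 * d) \<in> block_chords (ladder_block n d r)"
proof -
  have "ladder_block n d r = {r, r + d, r + 2 * d}"
    using assms by (auto simp: ladder_block_def)
  then show ?thesis using assms by (simp add: block_chords_def)
qed

lemma card_le_cross_count:
  assumes "finite D" "finite E" "X \<subseteq> {(e, f). e \<in> D \<and> f \<in> E \<and> chords_cross e f}"
  shows "card X \<le> cross_count D E"
  unfolding cross_count_def using finite_cross_pairs[OF assms(1,2)] assms(3) by (rule card_mono)

lemma finite_ladder_block [simp]: "finite (ladder_block n d r)"
  by (simp add: ladder_block_def)

text \<open>A block that lacks its third point loses at most one of the three crossings of two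
  triples; writing this as a correction keeps the later summation linear.\<close>

lemma ladder_arcs_cross_ge:
  assumes r: "1 \<le> r" "r < s" "s \<le> d" and n: "2 * d \<le> n"
  shows "3 \<le> cross_count (block_arcs (ladder_block n d r)) (block_arcs (ladder_block n d s))
              + of_bool (n < r + 2 * d) + of_bool (n < s + 2 * d)"
proof -
  have "d > 0" using r by simp
  note R = ladder_block_arcs[of r d n, OF r(1) this]
  note S = ladder_block_arcs[of s d n, OF less_imp_le[OF le_less_trans[OF r(1,2)]] \<open>d > 0\<close>]
  let ?a = "((r, r + d), (s, s + d))" and ?b = "((r + d, r + 2 * d), (s, s + d))"
    and ?c = "((r + d, r + 2 * d), (s + d, s + 2 * d))"
  note ge = card_le_cross_count[OF finite_block_arcs[OF finite_ladder_block] finite_block_arcs[OF finite_ladder_block]]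
  consider "s + 2 * d \<le> n" | "r + 2 * d \<le> n" "n < s + 2 * d" | "n < r + 2 * d" by linarith
  then show ?thesis
  proof cases
    case 1
    then have "card {?a, ?b, ?c} \<le> cross_count (block_arcs (ladder_block n d r)) (block_arcs (ladder_block n d s))"
      using r n R S by (intro ge) (auto simp: chords_cross_def)
    then show ?thesis using r by simp
  next
    case 2
    then have "card {?a, ?b} \<le> cross_count (block_arcs (ladder_block n d r)) (block_arcs (ladder_block n d s))"
      using r n R S by (intro ge) (auto simp: chords_cross_def)
    then show ?thesis using r 2 by simp
  next
    case 3
    then have "card {?a} \<le> cross_count (block_arcs (ladder_block n d r)) (block_arcs (ladder_block n d s))"
      using r n R S by (intro ge) (auto simp: chords_cross_def)
    then show ?thesis using r 3 by simp
  qed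
qed

text \<open>Two triples give all six crossings of interleaved triangles, a triple and a block of size two give two. Charging
  four to each block of size two is exact in both cases, and for two of them the inequality is void.\<close>

lemma ladder_chords_cross_ge:
  assumes r: "1 \<le> r" "r < s" "s \<le> d" and n: "2 * d \<le> n"
  shows "6 \<le> cross_count (block_chords (ladder_block n d r)) (block_chords (ladder_block n d s))
              + 4 * of_bool (n < r + 2 * d) + 4 * of_bool (n < s + 2 * d)"
proof -
  have d: "d > 0" "1 \<le> s" using r by simp_all
  note R = ladder_block_arcs[of r d n, OF r(1) d(1), THEN subsetD[OF block_arcs_subset_chords]]
    ladder_block_closing_chord[of r d n, OF r(1) d(1)]
  note S = ladder_block_arcs[of s d n, OF d(2,1), THEN subsetD[OF block_arcs_subset_chords]]
    ladder_block_closing_chord[of s d n, OF d(2,1)]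
  let ?a = "((r, r + d), (s, s + d))" and ?b = "((r + d, r + 2 * d), (s, s + d))"
    and ?c = "((r + d, r + 2 * d), (s + d, s + 2 * d))" and ?d = "((r, r + d), (s, s + 2 * d))"
    and ?e = "((r, r + 2 * d), (s, s + 2 * d))" and ?f = "((r, r + 2 * d), (s + d, s + 2 * d))"
  note ge = card_le_cross_count[OF finite_block_chords[OF finite_ladder_block] finite_block_chords[OF finite_ladder_block]]
  consider "s + 2 * d \<le> n" | "r + 2 * d \<le> n" "n < s + 2 * d" | "n < r + 2 * d" by linarith
  then show ?thesis
  proof cases
    case 1
    then have "card {?a, ?b, ?c, ?d, ?e, ?f}
        \<le> cross_count (block_chords (ladder_block n d r)) (block_chords (ladder_block n d s))"
      using r n R S by (intro ge) (auto simp: chords_cross_def)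
    then show ?thesis using r by simp
  next
    case 2
    then have "card {?a, ?b} \<le> cross_count (block_chords (ladder_block n d r)) (block_chords (ladder_block n d s))"
      using r n R S by (intro ge) (auto simp: chords_cross_def)
    then show ?thesis using r 2 by simp
  next
    case 3
    then show ?thesis using r by simp
  qed
qed

lemma sum_ordered_pairs:
  fixes h :: "'a \<Rightarrow> int"
  assumes "finite I"
  shows "(\<Sum>i\<in>I. \<Sum>j\<in>I - {i}. h i + h j) = 2 * (int (card I) - 1) * (\<Sum>i\<in>I. h i)"
proof -
  have "(\<Sum>i\<in>I. \<Sum>j\<in>I - {i}. h i + h j) = (\<Sum>i\<in>I. (int (card I) - 2) * h i + (\<Sum>j\<in>I. h j))"
  proof (rule sum.cong[OF refl])
    fix i assume i: "i \<in> I"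
    then have "card I > 0" using assms by (auto simp: card_gt_0_iff)
    then have c: "int (card I) = 1 + int (card (I - {i}))" using i by simp
    show "(\<Sum>j\<in>I - {i}. h i + h j) = (int (card I) - 2) * h i + (\<Sum>j\<in>I. h j)"
      using sum.remove[OF assms i, of h] by (simp add: c sum.distrib algebra_simps)
  qed
  also have "\<dots> = (int (card I) - 2) * (\<Sum>i\<in>I. h i) + int (card I) * (\<Sum>j\<in>I. h j)"
    by (simp add: sum.distrib flip: sum_distrib_left)
  finally show ?thesis by (simp add: algebra_simps)
qed

text \<open>There are \<open>3d - n\<close> blocks of size two, and \<open>c\<close> is charged for each ordered pair and each such block
  in it.\<close>

lemma ladder_crossings_ge:
  fixes c k :: int
  assumes n: "2 * d \<le> n" "n \<le> 3 * d"
    and D: "\<And>B. D B \<subseteq> block_chords B"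
    and pair: "\<And>r s. 1 \<le> r \<Longrightarrow> r < s \<Longrightarrow> s \<le> d \<Longrightarrow>
      k \<le> int (cross_count (D (ladder_block n d r)) (D (ladder_block n d s)))
            + c * of_bool (n < r + 2 * d) + c * of_bool (n < s + 2 * d)"
  shows "k * int d * (int d - 1)
    \<le> 2 * int (crossings (\<Union>B\<in>ladder n d. D B)) + 2 * c * (int d - 1) * (3 * int d - int n)"
proof -
  let ?b = "ladder_block n d"
  define N where "N B C = int (cross_count (D B) (D C))" for B C
  define h :: "nat \<Rightarrow> int" where "h r = c * of_bool (n < r + 2 * d)" for r
  have P: "partition_on {1..n} (ladder n d)" using ladder_partition n by simp
  have inj: "inj_on ?b {1..d}"
  proof (rule inj_onI, rule ccontr)
    fix r s assume rs: "r \<in> {1..d}" "s \<in> {1..d}" "?b r = ?b s" "r \<noteq> s"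
    then have "?b r = {}" using ladder_block_disjoint[of r d s n] by simp
    then show False using rs n by (auto simp: ladder_block_def)
  qed
  have "2 * int (crossings (\<Union>B\<in>ladder n d. D B)) = (\<Sum>B\<in>?b ` {1..d}. \<Sum>C\<in>?b ` {1..d} - {B}. N B C)"
    using arg_cong[OF double_crossings_partition[OF P D], of int] by (simp add: N_def ladder_def)
  also have "\<dots> = (\<Sum>r\<in>{1..d}. \<Sum>C\<in>?b ` {1..d} - {?b r}. N (?b r) C)"
    by (subst sum.reindex[OF inj]) (simp only: comp_def)
  also have "\<dots> = (\<Sum>r\<in>{1..d}. \<Sum>s\<in>{1..d} - {r}. N (?b r) (?b s))"
  proof (rule sum.cong[OF refl])
    fix r assume r: "r \<in> {1..d}"
    then have image: "?b ` {1..d} - {?b r} = ?b ` ({1..d} - {r})"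
      using inj_on_image_set_diff[OF inj, of "{1..d}" "{r}"] by simp
    have inj_r: "inj_on ?b ({1..d} - {r})" using inj by (rule inj_on_subset) auto
    show "(\<Sum>C\<in>?b ` {1..d} - {?b r}. N (?b r) C) = (\<Sum>s\<in>{1..d} - {r}. N (?b r) (?b s))"
      unfolding image by (subst sum.reindex[OF inj_r]) (simp only: comp_def)
  qed
  finally have crossings: "2 * int (crossings (\<Union>B\<in>ladder n d. D B))
      = (\<Sum>r\<in>{1..d}. \<Sum>s\<in>{1..d} - {r}. N (?b r) (?b s))" .
  have bound: "k \<le> N (?b r) (?b s) + (h r + h s)" if "r \<in> {1..d}" "s \<in> {1..d} - {r}" for r s
  proof (cases "r < s")
    case True
    then show ?thesis using pair[of r s] that by (simp add: N_def h_def)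
  next
    case False
    then show ?thesis using pair[of s r] that by (simp add: N_def h_def cross_count_commute)
  qed
  have pairs: "(\<Sum>r\<in>{1..d}. h r) = c * (3 * int d - int n)"
  proof -
    have "{r \<in> {1..d}. n < r + 2 * d} = {n - 2 * d <..d}" using n by auto
    then have "(\<Sum>r\<in>{1..d}. of_bool (n < r + 2 * d) :: int) = 3 * int d - int n"
      using n by (simp add: of_bool_def sum.If_cases Int_def conj_commute)
    then show ?thesis by (simp add: h_def flip: sum_distrib_left)
  qed
  have "k * int d * (int d - 1) = (\<Sum>r\<in>{1..d}. \<Sum>s\<in>{1..d} - {r}. k)"
    by (cases d) (simp_all add: algebra_simps)
  also have "\<dots> \<le> (\<Sum>r\<in>{1..d}. \<Sum>s\<in>{1..d} - {r}. N (?b r) (?b s) + (h r + h s))"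
    by (intro sum_mono bound)
  also have "\<dots> = (\<Sum>r\<in>{1..d}. \<Sum>s\<in>{1..d} - {r}. N (?b r) (?b s))
      + (\<Sum>r\<in>{1..d}. \<Sum>s\<in>{1..d} - {r}. h r + h s)"
    by (simp only: sum.distrib)
  also have "\<dots> = 2 * int (crossings (\<Union>B\<in>ladder n d. D B))
      + 2 * (int d - 1) * (c * (3 * int d - int n))"
    using sum_ordered_pairs[of "{1..d}" h] crossings pairs by simp
  finally show ?thesis by (simp add: algebra_simps)
qed

text \<open>For \<open>d = (n + 2) div 3\<close> half of the left side is the linear maximum.\<close>

lemma cr_linear_ladder_ge:
  assumes "2 * d \<le> n" "n \<le> 3 * d"
  shows "(int d - 1) * (2 * int n - 3 * int d) \<le> 2 * int (cr_linear (ladder n d))"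
proof -
  have "3 * int d * (int d - 1)
      \<le> 2 * int (crossings (\<Union>B\<in>ladder n d. block_arcs B)) + 2 * 1 * (int d - 1) * (3 * int d - int n)"
  proof (rule ladder_crossings_ge[OF assms block_arcs_subset_chords])
    fix r s assume "1 \<le> r" "r < s" "s \<le> d"
    from ladder_arcs_cross_ge[OF this assms(1)]
    show "3 \<le> int (cross_count (block_arcs (ladder_block n d r)) (block_arcs (ladder_block n d s)))
        + 1 * of_bool (n < r + 2 * d) + 1 * of_bool (n < s + 2 * d)"
      by (auto split: if_splits simp: of_bool_def)
  qed
  then show ?thesis by (simp add: cr_linear_def linear_arcs_def algebra_simps)
qed

text \<open>The value is optimal for \<open>n = 3d\<close>, and for \<open>n = 3d - 1\<close>, where the only block of size two
  crosses every triangle twice.\<close>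

lemma cr_circular_ladder_ge:
  assumes "2 * d \<le> n" "n \<le> 3 * d"
  shows "(int d - 1) * (4 * int n - 9 * int d) \<le> int (cr_circular (ladder n d))"
proof -
  have "6 * int d * (int d - 1)
      \<le> 2 * int (crossings (\<Union>B\<in>ladder n d. block_chords B)) + 2 * 4 * (int d - 1) * (3 * int d - int n)"
  proof (rule ladder_crossings_ge[OF assms order_refl])
    fix r s assume "1 \<le> r" "r < s" "s \<le> d"
    from ladder_chords_cross_ge[OF this assms(1)]
    show "6 \<le> int (cross_count (block_chords (ladder_block n d r)) (block_chords (ladder_block n d s)))
        + 4 * of_bool (n < r + 2 * d) + 4 * of_bool (n < s + 2 * d)"
      by (auto split: if_splits simp: of_bool_def)
  qed
  then show ?thesis by (simp add: cr_circular_def circular_chords_def algebra_simps)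
qed

text \<open>For \<open>n\<close> of the form \<open>3d + 1\<close> the optimal circular value is that of \<open>3d\<close>.\<close>

lemma partition_insert_singleton:
  assumes P: "partition_on {1..n} P"
  shows "partition_on {1..Suc n} (insert {Suc n} P)"
    and "cr_circular (insert {Suc n} P) = cr_circular P"
proof -
  have "disjnt {Suc n} (\<Union>P)" using partition_onD1[OF P, symmetric] by auto
  moreover have "{1..Suc n} - {Suc n} = {1..n}" by auto
  ultimately show "partition_on {1..Suc n} (insert {Suc n} P)"
    using P partition_on_insert[of "{Suc n}" P "{1..Suc n}"] by simp
  show "cr_circular (insert {Suc n} P) = cr_circular P"
  proof -
    have "block_chords {Suc n} = {}" by (simp add: block_chords_def block_arcs_def)
    then show ?thesis by (simp add: cr_circular_def circular_chords_def)
  qed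
qed

section \<open>The maximal values\<close>

lemma finite_set_partitions: "finite (set_partitions n)"
  by (rule finite_subset[of _ "Pow (Pow {1..n})"]) (auto simp: set_partitions_def partition_on_def)

lemma Max_image_eqI:
  fixes f :: "'a \<Rightarrow> nat"
  assumes "finite A" "x \<in> A" "v \<le> f x" "\<And>y. y \<in> A \<Longrightarrow> f y \<le> v"
  shows "Max (f ` A) = v"
  using assms by (intro Max_eqI) (auto intro!: image_eqI[of _ _ x] antisym)

lemma int_choose_two: "n \<ge> 1 \<Longrightarrow> 2 * int ((n - 1) choose 2) = (int n - 1) * (int n - 2)"
proof -
  assume "n \<ge> 1"
  then obtain m where m: "n = Suc m" by (cases n) auto
  have "even (m * (m - 1))" by auto
  then have "2 * (m choose 2) = m * (m - 1)" unfolding choose_two by (rule dvd_mult_div_cancel)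
  then have "2 * int (m choose 2) = int m * int (m - 1)" by (metis of_nat_mult of_nat_numeral)
  then show ?thesis by (cases m) (simp_all add: m algebra_simps)
qed

text \<open>For \<open>n = 1\<close> the lower bound for ladders does not apply, since \<open>2d\<close> exceeds \<open>n\<close>, but the maximum is
  \<open>0\<close>. For the other \<open>n\<close> the ladder misses \<open>(n - 1)(n - 2)/6\<close> by at most \<open>1/3\<close>.\<close>

lemma M_linear_eq:
  assumes "n \<ge> 1"
  shows "M_linear n = ((n - 1) choose 2) div 3"
proof -
  let ?q = "(n - 1) choose 2"
  define d where "d = (n + 2) div 3"
  obtain P where P: "partition_on {1..n} P" and low: "int ?q \<le> 3 * int (cr_linear P) + 1"
  proof (cases "n = 1")
    case True
    have "partition_on {1..n} {{1..n}}"
      using True by (intro partition_on_space) auto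
    then show ?thesis by (rule that) (simp add: True numeral_2_eq_2)
  next
    case False
    have n: "2 * d \<le> n" "n \<le> 3 * d" "n = 3 * d \<or> n + 1 = 3 * d \<or> n + 2 = 3 * d"
      using assms False unfolding d_def by presburger+
    have "6 * int (cr_linear (ladder n d)) \<ge> (int n - 1) * (int n - 2) - 2"
    proof -
      have "3 * ((int d - 1) * (2 * int n - 3 * int d)) \<ge> (int n - 1) * (int n - 2) - 2"
        using n(3)
      proof (elim disjE)
        assume "n = 3 * d"
        then show ?thesis by (simp add: algebra_simps)
      next
        assume "n + 1 = 3 * d"
        then have int_n: "int n = 3 * int d - 1" by linarith
        show ?thesis unfolding int_n by (simp add: algebra_simps)
      next
        assume "n + 2 = 3 * d"
        then have int_n: "int n = 3 * int d - 2" by linarith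
        show ?thesis unfolding int_n by (simp add: algebra_simps)
      qed
      with cr_linear_ladder_ge[OF n(1,2)] show ?thesis by linarith
    qed
    then have "int ?q \<le> 3 * int (cr_linear (ladder n d)) + 1"
      using int_choose_two[OF assms] by linarith
    moreover have "partition_on {1..n} (ladder n d)" using n by (intro ladder_partition) auto
    ultimately show ?thesis using that by blast
  qed
  show ?thesis unfolding M_linear_def
  proof (rule Max_image_eqI[OF finite_set_partitions])
    show "P \<in> set_partitions n" using P by (simp add: set_partitions_def)
    show "?q div 3 \<le> cr_linear P" using low by linarith
    fix Q assume "Q \<in> set_partitions n"
    then have "6 * int (cr_linear Q) \<le> 2 * int ?q"
      using cr_linear_le int_choose_two[OF assms] by (simp add: set_partitions_def)
    then show "cr_linear Q \<le> ?q div 3" by linarith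
  qed
qed

lemma M_circular_eqI:
  assumes P: "partition_on {1..n} P" and low: "2 * int q \<le> 3 * int (cr_circular P) + 2"
    and up: "\<And>Q. partition_on {1..n} Q \<Longrightarrow> 3 * int (cr_circular Q) \<le> 2 * int q"
  shows "M_circular n = 2 * q div 3"
  unfolding M_circular_def
proof (rule Max_image_eqI[OF finite_set_partitions])
  show "P \<in> set_partitions n" using P by (simp add: set_partitions_def)
  show "2 * q div 3 \<le> cr_circular P" using low by linarith
  fix Q assume "Q \<in> set_partitions n"
  then show "cr_circular Q \<le> 2 * q div 3"
    using up[of Q] by (simp add: set_partitions_def)
qed

lemma M_circular_eq_mod_0:
  assumes "n \<ge> 1" "n mod 3 = 0"
  shows "M_circular n = 2 * ((n - 1) choose 2) div 3"
proof -
  define d where "d = n div 3"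
  have n: "n = 3 * d" using assms by (auto simp: d_def)
  note choose = int_choose_two[of n]
  show ?thesis
  proof (rule M_circular_eqI)
    show "partition_on {1..n} (ladder n d)" using n by (intro ladder_partition) auto
    have "(int d - 1) * (4 * int n - 9 * int d) \<le> int (cr_circular (ladder n d))"
      using n by (intro cr_circular_ladder_ge) auto
    then show "2 * int ((n - 1) choose 2) \<le> 3 * int (cr_circular (ladder n d)) + 2"
      using choose assms n by (simp add: algebra_simps)
  next
    show "3 * int (cr_circular Q) \<le> 2 * int ((n - 1) choose 2)" if "partition_on {1..n} Q" for Q
      using cr_circular_le[OF that] choose assms by simp
  qed
qed

lemma M_circular_eq_mod_1_2:
  assumes "n \<ge> 5" "n mod 3 = 1 \<or> n mod 3 = 2"
  shows "M_circular n = 2 * ((n - 2) choose 2) div 3"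
proof -
  have choose: "2 * int ((n - 2) choose 2) = (int n - 2) * (int n - 3)"
  proof -
    obtain m where m: "n = Suc (Suc m)" using assms(1) by (auto dest!: le_Suc_ex)
    show ?thesis using int_choose_two[of "Suc m"] by (simp add: m algebra_simps)
  qed
  have up: "3 * int (cr_circular Q) \<le> 2 * int ((n - 2) choose 2)" if "partition_on {1..n} Q" for Q
    using cr_circular_le_not_all_triples[OF that assms(1)] all_triples_dvd[OF that] assms(2) choose
    by (metis mod_0 one_neq_zero zero_neq_numeral)
  from assms(2) show ?thesis
  proof
    assume "n mod 3 = 1"
    define d where "d = n div 3"
    have n: "n = Suc (3 * d)" using \<open>n mod 3 = 1\<close> unfolding d_def by presburger
    have P: "partition_on {1..3 * d} (ladder (3 * d) d)" by (intro ladder_partition) auto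
    have "(int d - 1) * (4 * int (3 * d) - 9 * int d) \<le> int (cr_circular (ladder (3 * d) d))"
      by (intro cr_circular_ladder_ge) auto
    then have "2 * int ((n - 2) choose 2) \<le> 3 * int (cr_circular (ladder (3 * d) d)) + 2"
      using choose n by (simp add: algebra_simps)
    then show ?thesis
      using M_circular_eqI[OF _ _ up] partition_insert_singleton[OF P] n by metis
  next
    assume "n mod 3 = 2"
    define d where "d = (n + 1) div 3"
    have n: "n + 1 = 3 * d" "int n = 3 * int d - 1" "d \<ge> 1"
      using \<open>n mod 3 = 2\<close> unfolding d_def by presburger+
    show ?thesis
    proof (rule M_circular_eqI[OF _ _ up])
      show "partition_on {1..n} (ladder n d)" using n by (intro ladder_partition) auto
      have "(int d - 1) * (4 * int n - 9 * int d) \<le> int (cr_circular (ladder n d))"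
        using n by (intro cr_circular_ladder_ge) auto
      then show "2 * int ((n - 2) choose 2) \<le> 3 * int (cr_circular (ladder n d)) + 2"
        using choose n(2) by (simp add: algebra_simps)
    qed
  qed
qed

theorem theorem1p13:
  fixes n :: nat
  shows "(n \<ge> 1 \<longrightarrow>
            int (M_linear n) = \<lfloor>(1 / 3 :: real) * real ((n - 1) choose 2)\<rfloor>) \<and>
         (n \<ge> 5 \<and> n mod 3 = 0 \<longrightarrow>
            int (M_circular n) = \<lfloor>(2 / 3 :: real) * real ((n - 1) choose 2)\<rfloor>) \<and>
         (n \<ge> 5 \<and> (n mod 3 = 1 \<or> n mod 3 = 2) \<longrightarrow>
            int (M_circular n) = \<lfloor>(2 / 3 :: real) * real ((n - 2) choose 2)\<rfloor>)"
proof -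
  have floor: "\<lfloor>(real a / 3) * real q\<rfloor> = int (a * q div 3)" for a q :: nat
    using floor_divide_of_nat_eq[of "a * q" 3, where ?'a = real] by simp
  show ?thesis
    using floor[of 1] floor[of 2] M_linear_eq M_circular_eq_mod_0 M_circular_eq_mod_1_2
    by simp
qed

end
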